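(* For all $n\ge 1$ and $k\in[n]$, the map $\rho'$ is a bijection from $\mathcal{MM}'_{n,k}$ onto $\mathcal{MM}''_{n,k}$. Therefore $|\mathcal{MM}''_{n,k}|=E_{n,k}$ for all $1\le k\le n$.
   Context: $[n]=\{1,\dots,n\}$. $E_{n,k}$ is the number of permutations $\pi$ of $[n]$ with $\pi_1>\pi_2<\pi_3>\cdots$ and $\pi_1=k$. A permutation is alternating if $\pi_1>\pi_2<\pi_3>\cdots$ or $\pi_1<\pi_2>\pi_3<\cdots$; $\mathcal{MM}_n$ is the set of alternating permutations of $[n]$ in which $1$ occurs before $n$. For $k\le n-1$, $\mathcal{MM}'_{n,k}$ is the set of $\pi\in\mathcal{MM}_n$ in which the letter immediately before $1$ is $k$, and $\mathcal{MM}'_{n,n}$ is the set of $\pi\in\mathcal{MM}_n$ with $\pi_1=1$. For $k\le n-1$, $\mathcal{MM}''_{n,k}$ is the set of $\pi\in\mathcal{MM}_n$ in which the letter immediately after $n$ is $n+1-k$, and $\mathcal{MM}''_{n,n}$ is the set of $\pi\in\mathcal{MM}_n$ with $\pi_n=n$. For $\pi\in\mathcal{MM}_n$, $\rho'(\pi)=\overline{\pi^R}$, where $\pi^R=\pi_n\cdots\pi_1$ and $\overline{w}_i=n+1-w_i$. *)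

theory Defs
  imports "HOL-Combinatorics.Multiset_Permutations"
begin

text \<open>
  Permutations of \<open>[n]\<close> are words, i.e. lists in \<open>permutations_of_set {1..n}\<close>.
  List positions start at 0, so the letter \<open>\<pi>\<^sub>i\<close> is \<open>\<pi> ! (i - 1)\<close>.
\<close>

text \<open>\<open>\<pi>\<^sub>1 > \<pi>\<^sub>2 < \<pi>\<^sub>3 > \<dots>\<close>\<close>
definition down_up :: "nat list \<Rightarrow> bool" where
  "down_up \<pi> \<longleftrightarrow>
     (\<forall>i. Suc i < length \<pi> \<longrightarrow>
        (if even i then \<pi> ! i > \<pi> ! Suc i else \<pi> ! i < \<pi> ! Suc i))"

text \<open>\<open>\<pi>\<^sub>1 < \<pi>\<^sub>2 > \<pi>\<^sub>3 < \<dots>\<close>\<close>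
definition up_down :: "nat list \<Rightarrow> bool" where
  "up_down \<pi> \<longleftrightarrow>
     (\<forall>i. Suc i < length \<pi> \<longrightarrow>
        (if even i then \<pi> ! i < \<pi> ! Suc i else \<pi> ! i > \<pi> ! Suc i))"

definition alternating :: "nat list \<Rightarrow> bool" where
  "alternating \<pi> \<longleftrightarrow> down_up \<pi> \<or> up_down \<pi>"

definition entringer :: "nat \<Rightarrow> nat \<Rightarrow> nat" where
  "entringer n k = card {\<pi> \<in> permutations_of_set {1..n}. down_up \<pi> \<and> \<pi> ! 0 = k}"

text \<open>
  The inequality between the positions is weak only for the sake of \<open>n = 1\<close>, where the
  letters \<open>1\<close> and \<open>n\<close> coincide and the one-letter word has to belong to \<open>MM 1\<close>.
  For \<open>n \<ge> 2\<close> the two letters differ and the inequality is automatically strict.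
\<close>
definition MM :: "nat \<Rightarrow> nat list set" where
  "MM n = {\<pi> \<in> permutations_of_set {1..n}. alternating \<pi> \<and>
             (\<exists>i j. i \<le> j \<and> j < length \<pi> \<and> \<pi> ! i = 1 \<and> \<pi> ! j = n)}"

definition immediately_before :: "nat \<Rightarrow> nat \<Rightarrow> nat list \<Rightarrow> bool" where
  "immediately_before a b \<pi> \<longleftrightarrow> (\<exists>i. Suc i < length \<pi> \<and> \<pi> ! i = a \<and> \<pi> ! Suc i = b)"

text \<open>The next two sets are only meaningful for \<open>1 \<le> k \<le> n\<close>.\<close>

definition MM' :: "nat \<Rightarrow> nat \<Rightarrow> nat list set" where
  "MM' n k = (if k = n then {\<pi> \<in> MM n. \<pi> ! 0 = 1}
              else {\<pi> \<in> MM n. immediately_before k 1 \<pi>})"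

definition MM'' :: "nat \<Rightarrow> nat \<Rightarrow> nat list set" where
  "MM'' n k = (if k = n then {\<pi> \<in> MM n. \<pi> ! (n - 1) = n}
               else {\<pi> \<in> MM n. immediately_before n (n + 1 - k) \<pi>})"

definition complement :: "nat list \<Rightarrow> nat list" where
  "complement w = map (\<lambda>a. length w + 1 - a) w"

definition rho' :: "nat list \<Rightarrow> nat list" where
  "rho' \<pi> = complement (rev \<pi>)"

end

theory Submission
  imports Defs
begin

text \<open>
  Split a word of \<open>MM' n k\<close>, \<open>k < n\<close>, as \<open>A k 1 B\<close>; then \<open>n\<close> occurs in \<open>B\<close>.  The word
  \<open>k A\<^sup>R\<close> is down-up.  If \<open>A\<close> has even length, this word ends with a peak and
  \<open>k A\<^sup>R 1 B\<close> is a down-up permutation starting with \<open>k\<close> in which \<open>1\<close> precedes \<open>n\<close>.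
  If \<open>A\<close> has odd length, it ends with a valley; reversing the order of the letters of \<open>1 B\<close>
  gives an alternating word \<open>n B'\<close> on the same letters, and \<open>k A\<^sup>R n B'\<close> is a down-up
  permutation starting with \<open>k\<close> in which \<open>n\<close> precedes \<open>1\<close>.  Cutting a down-up permutation
  at the first occurrence of a letter \<open>1\<close> or \<open>n\<close> inverts this map.  For \<open>k = n\<close>
  complementation alone is the required bijection.
\<close>

section \<open>Alternating words\<close>

text \<open>One flag covers both patterns: \<open>True\<close> asks for a descent first,
  \<open>False\<close> for an ascent. Parity arguments then become equations between
  booleans.\<close>

fun zigzag :: "bool \<Rightarrow> nat list \<Rightarrow> bool" where
  "zigzag b (x # y # w) \<longleftrightarrow> (if b then x > y else x < y) \<and> zigzag (\<not> b) (y # w)"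
| "zigzag b w \<longleftrightarrow> True"

lemma zigzag_iff_nth:
  "zigzag b w \<longleftrightarrow>
     (\<forall>i. Suc i < length w \<longrightarrow> (if even i = b then w ! i > w ! Suc i else w ! i < w ! Suc i))"
proof (induction b w rule: zigzag.induct)
  case (1 b x y w)
  have all: "(\<forall>i. P i) \<longleftrightarrow> P 0 \<and> (\<forall>i. P (Suc i))" for P :: "nat \<Rightarrow> bool"
    by (metis not0_implies_Suc)
  show ?case
    unfolding zigzag.simps(1) 1 by (subst (2) all) auto
qed auto

lemma down_up_eq_zigzag: "down_up w = zigzag True w"
  by (simp add: down_up_def zigzag_iff_nth)

lemma up_down_eq_zigzag: "up_down w = zigzag False w"
  unfolding up_down_def zigzag_iff_nth by (rule all_cong1) auto

lemma alternating_iff_zigzag: "alternating w \<longleftrightarrow> (\<exists>b. zigzag b w)"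
  unfolding alternating_def down_up_eq_zigzag up_down_eq_zigzag by (metis (full_types))

text \<open>The flag flips once per letter of \<open>u\<close>, so \<open>v\<close> starts with
  \<open>b = even (length u)\<close>; the junction is the step just before and carries the opposite
  flag.\<close>

lemma zigzag_append:
  "zigzag b (u @ v) \<longleftrightarrow> zigzag b u \<and> zigzag (b = even (length u)) v \<and>
     (u \<noteq> [] \<longrightarrow> v \<noteq> [] \<longrightarrow>
        (if b = odd (length u) then last u > hd v else last u < hd v))"
proof (induction b u rule: zigzag.induct)
  case ("2_2" b x)
  then show ?case by (cases v) auto
qed auto

text \<open>Reversal exchanges ascents and descents and starts with the former last step. An odd
  length means an even number of steps, where the two effects cancel.\<close>

lemma zigzag_rev: "zigzag b (rev w) = zigzag (b = odd (length w)) w"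
proof (induction w arbitrary: b)
  case (Cons x w)
  show ?case
  proof (cases w)
    case (Cons y v)
    have "zigzag b (rev (x # w)) \<longleftrightarrow>
        zigzag b (rev w) \<and> (if b = odd (length w) then y > x else y < x)"
      unfolding rev.simps(2)[of x w] zigzag_append using Cons by simp
    then show ?thesis
      unfolding Cons.IH by (cases b; cases "even (length v)") (simp_all add: Cons conj_commute)
  qed simp
qed simp

text \<open>Strict decrease is asked for only on the letters of \<open>w\<close>, so that truncated
  subtraction and the order reversal of a letter set both qualify.\<close>

lemma zigzag_map_antimono:
  assumes "\<And>x y. x \<in> set w \<Longrightarrow> y \<in> set w \<Longrightarrow> x < y \<Longrightarrow> f y < f x"
  shows "zigzag b (map f w) = zigzag (\<not> b) w"
  using assms
proof (induction b w rule: zigzag.induct)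
  case (1 b x y w)
  have "f x < f y \<longleftrightarrow> y < x" "f y < f x \<longleftrightarrow> x < y"
    using 1(2)[of x y] 1(2)[of y x] by (cases x y rule: linorder_cases; force)+
  moreover have "zigzag (\<not> b) (map f (y # w)) = zigzag (\<not> \<not> b) (y # w)"
    using 1(2) by (intro 1(1)) auto
  ultimately show ?case by simp
qed auto

section \<open>Factors of words and the relative order of two letters\<close>

lemma immediately_before_iff_append:
  "immediately_before a b w \<longleftrightarrow> (\<exists>u v. w = u @ a # b # v)"
proof
  assume "immediately_before a b w"
  then obtain i where "Suc i < length w" "w ! i = a" "w ! Suc i = b"
    by (auto simp: immediately_before_def)
  then have "w = take i w @ a # b # drop (Suc (Suc i)) w"
    by (metis Cons_nth_drop_Suc Suc_lessD append_take_drop_id)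
  then show "\<exists>u v. w = u @ a # b # v" by blast
next
  assume "\<exists>u v. w = u @ a # b # v"
  then obtain u v where w: "w = u @ a # b # v" by blast
  show "immediately_before a b w"
    unfolding immediately_before_def w by (rule exI[of _ "length u"]) (simp add: nth_append)
qed

lemma nth_le_nth_iff_append:
  "(\<exists>i j. i \<le> j \<and> j < length w \<and> w ! i = a \<and> w ! j = b) \<longleftrightarrow>
     (\<exists>u v. w = u @ a # v \<and> b \<in> set (a # v))"
proof
  assume "\<exists>i j. i \<le> j \<and> j < length w \<and> w ! i = a \<and> w ! j = b"
  then obtain i j where ij: "i \<le> j" "j < length w" "w ! i = a" "w ! j = b" by blast
  then have "w = take i w @ a # drop (Suc i) w" "drop i w = a # drop (Suc i) w"
    using id_take_nth_drop[of i w] Cons_nth_drop_Suc[of i w] by auto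
  moreover have "b \<in> set (drop i w)"
    using ij by (auto simp: in_set_conv_nth intro!: exI[of _ "j - i"])
  ultimately show "\<exists>u v. w = u @ a # v \<and> b \<in> set (a # v)" by metis
next
  assume "\<exists>u v. w = u @ a # v \<and> b \<in> set (a # v)"
  then obtain u v where w: "w = u @ a # v" "b \<in> set (a # v)" by blast
  then obtain m where m: "m < length (a # v)" "(a # v) ! m = b"
    unfolding in_set_conv_nth by blast
  show "\<exists>i j. i \<le> j \<and> j < length w \<and> w ! i = a \<and> w ! j = b"
    using m by (intro exI[of _ "length u"] exI[of _ "length u + m"]) (simp add: w nth_append)
qed

section \<open>Complementation and the map \<open>\<rho>'\<close>\<close>

lemma length_permutation: "w \<in> permutations_of_set {1..n} \<Longrightarrow> length w = n"
  using length_finite_permutations_of_set[of w "{1..n}"] by simp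

lemma complement_permutation:
  assumes "w \<in> permutations_of_set {1..n}"
  shows "complement w \<in> permutations_of_set {1..n}"
proof -
  have "inj_on (\<lambda>a. n + 1 - a) {1..n}"
    by (auto intro!: inj_onI)
  moreover have "(\<lambda>a. n + 1 - a) ` {1..n} = {1..n}"
  proof (intro equalityI subsetI)
    fix x assume "x \<in> {1..n}"
    then show "x \<in> (\<lambda>a. n + 1 - a) ` {1..n}"
      by (intro image_eqI[of _ _ "n + 1 - x"]) auto
  qed auto
  ultimately show ?thesis
    using assms length_permutation[OF assms]
    by (auto simp: complement_def permutations_of_set_def distinct_map)
qed

lemma complement_complement:
  assumes "w \<in> permutations_of_set {1..n}"
  shows "complement (complement w) = w"
  using assms length_permutation[OF assms]
  by (auto simp: complement_def permutations_of_set_def intro!: map_idI)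

lemma zigzag_complement:
  assumes "w \<in> permutations_of_set {1..n}"
  shows "zigzag b (complement w) = zigzag (\<not> b) w"
  unfolding complement_def length_permutation[OF assms]
  using assms by (intro zigzag_map_antimono) (auto simp: permutations_of_set_def)

lemma rev_permutation:
  "w \<in> permutations_of_set A \<Longrightarrow> rev w \<in> permutations_of_set A"
  by (simp add: permutations_of_set_def)

lemma rho'_permutation:
  "w \<in> permutations_of_set {1..n} \<Longrightarrow> rho' w \<in> permutations_of_set {1..n}"
  unfolding rho'_def by (intro complement_permutation rev_permutation)

text \<open>Reversal and complementation are commuting involutions.\<close>

lemma rho'_rho':
  assumes "w \<in> permutations_of_set {1..n}"
  shows "rho' (rho' w) = w"
proof -
  have "rho' (rho' w) = complement (complement (rev (rev w)))"
    by (simp add: rho'_def complement_def rev_map)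
  then show ?thesis using complement_complement[OF assms] by simp
qed

lemma alternating_rho':
  assumes "w \<in> permutations_of_set {1..n}" "alternating w"
  shows "alternating (rho' w)"
proof -
  obtain b where "zigzag b w" using assms(2) alternating_iff_zigzag by blast
  then have "zigzag (\<not> (b = odd (length w))) (rho' w)"
    unfolding rho'_def zigzag_complement[OF rev_permutation[OF assms(1)]] zigzag_rev
    by (cases b) auto
  then show ?thesis using alternating_iff_zigzag by blast
qed

lemma nth_rho':
  assumes "w \<in> permutations_of_set {1..n}" "i < n"
  shows "rho' w ! i = n + 1 - w ! (n - Suc i)"
  using assms length_permutation[OF assms(1)] by (simp add: rho'_def complement_def rev_nth)

text \<open>Reversing positions puts \<open>n\<close> before \<open>1\<close>, but complementation
  exchanges these two letters and restores the order.\<close>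

lemma rho'_MM:
  assumes "w \<in> MM n"
  shows "rho' w \<in> MM n"
proof -
  have w: "w \<in> permutations_of_set {1..n}" and alt: "alternating w"
    using assms by (auto simp: MM_def)
  obtain i j where ij: "i \<le> j" "j < n" "w ! i = 1" "w ! j = n"
    using assms length_permutation[OF w] by (auto simp: MM_def)
  have "n - Suc j \<le> n - Suc i \<and> n - Suc i < length (rho' w) \<and>
      rho' w ! (n - Suc j) = 1 \<and> rho' w ! (n - Suc i) = n"
    using ij nth_rho'[OF w] length_permutation[OF rho'_permutation[OF w]]
    by (auto simp: Suc_diff_Suc)
  then show ?thesis
    using rho'_permutation[OF w] alternating_rho'[OF w alt] unfolding MM_def by blast
qed

lemma immediately_before_rho':
  assumes "w \<in> permutations_of_set {1..n}" "immediately_before a b w"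
  shows "immediately_before (n + 1 - b) (n + 1 - a) (rho' w)"
proof -
  obtain u v where w: "w = u @ a # b # v"
    using assms(2) immediately_before_iff_append by blast
  have "rho' w = map (\<lambda>a. n + 1 - a) (rev w)"
    using length_permutation[OF assms(1)] by (simp add: rho'_def complement_def)
  then have "rho' w = map (\<lambda>a. n + 1 - a) (rev v) @ (n + 1 - b) # (n + 1 - a) #
      map (\<lambda>a. n + 1 - a) (rev u)"
    by (simp add: w)
  then show ?thesis using immediately_before_iff_append by blast
qed

text \<open>As \<open>rho'\<close> is its own inverse, two inclusions suffice. The factor
  \<open>k 1\<close> becomes \<open>n (n + 1 - k)\<close> and conversely; for \<open>k = n\<close>
  an initial \<open>1\<close> and a final \<open>n\<close> correspond.\<close>

lemma bij_betw_rho':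
  assumes "n \<ge> 1" "k \<in> {1..n}"
  shows "bij_betw rho' (MM' n k) (MM'' n k)"
proof (rule bij_betw_byWitness[where f' = rho'])
  have MM_perm: "w \<in> permutations_of_set {1..n}" if "w \<in> MM n" for w
    using that by (simp add: MM_def)
  show "\<forall>w\<in>MM' n k. rho' (rho' w) = w" "\<forall>w\<in>MM'' n k. rho' (rho' w) = w"
    using rho'_rho' MM_perm by (auto simp: MM'_def MM''_def split: if_splits)
  show "rho' ` MM' n k \<subseteq> MM'' n k"
  proof (clarify)
    fix w assume w: "w \<in> MM' n k"
    then have "w \<in> MM n" by (auto simp: MM'_def split: if_splits)
    then show "rho' w \<in> MM'' n k"
      using w assms rho'_MM immediately_before_rho'[OF MM_perm, of w k 1]
        nth_rho'[OF MM_perm, of w "n - 1"]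
      by (auto simp: MM'_def MM''_def split: if_splits)
  qed
  show "rho' ` MM'' n k \<subseteq> MM' n k"
  proof (clarify)
    fix w assume w: "w \<in> MM'' n k"
    then have "w \<in> MM n" by (auto simp: MM''_def split: if_splits)
    then show "rho' w \<in> MM' n k"
      using w assms rho'_MM immediately_before_rho'[OF MM_perm, of w n "n + 1 - k"]
        nth_rho'[OF MM_perm, of w 0]
      by (auto simp: MM'_def MM''_def split: if_splits)
  qed
qed

section \<open>Reversing the order of a finite set\<close>

text \<open>The number of elements above \<open>x\<close> serves as an index into the ascending
  list, so for \<open>x\<close> in \<open>T\<close> the i-th largest element goes to the i-th
  smallest.\<close>

definition order_reversal :: "nat set \<Rightarrow> nat \<Rightarrow> nat" where
  "order_reversal T x = sorted_list_of_set T ! card {y \<in> T. x < y}"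

lemma card_greater_less:
  assumes "finite T" "x \<in> T"
  shows "card {y \<in> T. x < (y :: nat)} < card T"
  using assms by (intro psubset_card_mono) auto

lemma order_reversal_antimono:
  assumes "finite T" "x \<in> T" "y \<in> T" "x < y"
  shows "order_reversal T y < order_reversal T x"
proof -
  \<comment> \<open>The inclusion is strict because \<open>y\<close> lies above \<open>x\<close> but
    not above itself.\<close>
  have "card {z \<in> T. y < z} < card {z \<in> T. x < z}"
    using assms by (intro psubset_card_mono) auto
  then show ?thesis
    unfolding order_reversal_def
    using strict_sorted_list_of_set[of T] card_greater_less[OF assms(1,2)]
    by (intro sorted_wrt_nth_less[of "(<)"]) auto
qed

lemma bij_betw_order_reversal:
  assumes "finite T"
  shows "bij_betw (order_reversal T) T T"
proof -
  have "inj_on (order_reversal T) T"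
    by (rule linorder_inj_onI') (use order_reversal_antimono[OF assms] in fastforce)
  moreover have "order_reversal T ` T \<subseteq> T"
  proof clarify
    fix x assume "x \<in> T"
    then have "order_reversal T x \<in> set (sorted_list_of_set T)"
      unfolding order_reversal_def using card_greater_less[OF assms] by (intro nth_mem) simp
    then show "order_reversal T x \<in> T" using assms by simp
  qed
  ultimately show ?thesis
    using assms by (simp add: bij_betw_def endo_inj_surj)
qed

text \<open>A preimage \<open>z\<close> of \<open>b\<close> other than \<open>a\<close> would exceed
  \<open>a\<close>, and antitonicity would then force the image of \<open>a\<close> above the
  maximum \<open>b\<close>.\<close>

lemma order_reversal_least:
  assumes "finite T" "a \<in> T" "b \<in> T" "\<And>x. x \<in> T \<Longrightarrow> a \<le> x \<and> x \<le> b"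
  shows "order_reversal T a = b"
proof -
  obtain z where z: "z \<in> T" "order_reversal T z = b"
    using bij_betw_order_reversal[OF assms(1)] assms(3) by (metis bij_betw_imp_surj_on imageE)
  have "order_reversal T a \<le> b"
    using bij_betw_order_reversal[OF assms(1)] assms(2,4) by (auto simp: bij_betw_def)
  then show ?thesis
    using order_reversal_antimono[OF assms(1) assms(2) z(1)] z assms(4)[OF z(1)]
    by (cases "a = z") auto
qed

lemma zigzag_map_order_reversal:
  "zigzag b (map (order_reversal (set w)) w) = zigzag (\<not> b) w"
  by (intro zigzag_map_antimono order_reversal_antimono) auto

lemma distinct_map_order_reversal:
  assumes "distinct w"
  shows "distinct (map (order_reversal (set w)) w)"
    "set (map (order_reversal (set w)) w) = set w"
  using assms bij_betw_order_reversal[of "set w"] by (auto simp: bij_betw_def distinct_map)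

text \<open>The preimage word arises by applying the inverse bijection of the letter set to each
  letter of \<open>v\<close>.\<close>

lemma map_order_reversal_surj:
  obtains w where "v = map (order_reversal (set v)) w" "set w = set v"
    "distinct v \<Longrightarrow> distinct w"
proof -
  have bij: "bij_betw (order_reversal (set v)) (set v) (set v)"
    by (simp add: bij_betw_order_reversal)
  let ?g = "inv_into (set v) (order_reversal (set v))"
  have bij_inv: "bij_betw ?g (set v) (set v)"
    using bij by (rule bij_betw_inv_into)
  show thesis
  proof
    show "v = map (order_reversal (set v)) (map ?g v)"
      using bij by (auto simp: bij_betw_inv_into_right intro!: map_idI[symmetric])
    show "set (map ?g v) = set v" "distinct v \<Longrightarrow> distinct (map ?g v)"
      using bij_inv by (auto simp: bij_betw_def distinct_map)
  qed
qed

section \<open>Entringer numbers\<close>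

definition entringer_perms :: "nat \<Rightarrow> nat \<Rightarrow> nat list set" where
  "entringer_perms n k = {w \<in> permutations_of_set {1..n}. zigzag True w \<and> w ! 0 = k}"

lemma entringer_eq_card: "entringer n k = card (entringer_perms n k)"
  by (simp add: entringer_def entringer_perms_def down_up_eq_zigzag)

section \<open>Cutting the words of \<open>MM' n k\<close> at the letter \<open>k\<close>\<close>

text \<open>The pair \<open>(u, 1 # v)\<close> encodes the word \<open>u\<^sup>R k 1 v\<close> of \<open>MM' n k\<close>.\<close>
definition split_words :: "nat \<Rightarrow> nat \<Rightarrow> (nat list \<times> nat list) set" where
  "split_words n k =
     {(u, w). k # u @ w \<in> permutations_of_set {1..n} \<and> zigzag True (k # u) \<and> zigzag False w \<and>
        (\<exists>v. w = 1 # v) \<and> n \<in> set w}"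

text \<open>Counting from 0, the step from \<open>k\<close> down to \<open>1\<close> has index
  \<open>length u\<close>, which forces the starting flag \<open>even (length u)\<close>. Read
  backwards from \<open>k\<close>, the prefix is then down-up.\<close>

lemma zigzag_rev_Cons_append:
  assumes "1 < k"
  shows "zigzag (even (length u)) (rev u @ k # 1 # v) \<longleftrightarrow>
    zigzag True (k # u) \<and> zigzag False (1 # v)"
proof -
  have "zigzag (even (length u)) (rev u @ k # 1 # v) =
      zigzag (even (length u)) (rev (k # u) @ 1 # v)" by simp
  also have "\<dots> \<longleftrightarrow> zigzag True (k # u) \<and> zigzag False (1 # v)"
    unfolding zigzag_append zigzag_rev using assms by auto
  finally show ?thesis .
qed

lemma MM'_eq_image:
  assumes "1 \<le> k" "k < n"
  shows "MM' n k = (\<lambda>(u, w). rev u @ k # w) ` split_words n k"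
proof (intro equalityI subsetI)
  fix p assume p: "p \<in> MM' n k"
  then have perm: "p \<in> permutations_of_set {1..n}" and alt: "alternating p"
    and imm: "immediately_before k 1 p"
    and ord: "\<exists>i j. i \<le> j \<and> j < length p \<and> p ! i = 1 \<and> p ! j = n"
    using assms by (auto simp: MM'_def MM_def)
  obtain a v where p_eq: "p = a @ k # 1 # v"
    using imm immediately_before_iff_append by blast
  have dist: "distinct p" using perm by (simp add: permutations_of_set_def)
  then have k: "1 < k" using assms p_eq by auto
  obtain c d where "p = c @ 1 # d" "n \<in> set (1 # d)"
    using ord unfolding nth_le_nth_iff_append by blast
  \<comment> \<open>Distinctness gives \<open>1\<close> a unique occurrence, so both factorizations
    cut at the same place.\<close>
  moreover from this have "d = v"
    using dist p_eq append_Cons_eq_iff[of 1 c d "a @ [k]" v] by auto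
  ultimately have n: "n \<in> set (1 # v)" by simp
  obtain b where b: "zigzag b p" using alt alternating_iff_zigzag by blast
  have "b = even (length a)"
    using b k unfolding p_eq zigzag_append by (auto split: if_splits)
  then have "zigzag True (k # rev a)" "zigzag False (1 # v)"
    using b zigzag_rev_Cons_append[OF k, of "rev a" v] unfolding p_eq by simp_all
  then have "(rev a, 1 # v) \<in> split_words n k"
    using perm n unfolding split_words_def p_eq by (auto simp: permutations_of_set_def)
  then show "p \<in> (\<lambda>(u, w). rev u @ k # w) ` split_words n k"
    by (rule rev_image_eqI) (simp add: p_eq)
next
  fix p assume "p \<in> (\<lambda>(u, w). rev u @ k # w) ` split_words n k"
  then obtain u v where uv: "(u, 1 # v) \<in> split_words n k" and p: "p = rev u @ k # 1 # v"
    by (auto simp: split_words_def)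
  have perm: "p \<in> permutations_of_set {1..n}"
    using uv unfolding p split_words_def by (auto simp: permutations_of_set_def)
  then have "1 < k" using assms p by (auto simp: permutations_of_set_def)
  then have "zigzag (even (length u)) p"
    using uv zigzag_rev_Cons_append unfolding p split_words_def by auto
  then have "alternating p" using alternating_iff_zigzag by blast
  moreover have "\<exists>i j. i \<le> j \<and> j < length p \<and> p ! i = 1 \<and> p ! j = n"
    unfolding nth_le_nth_iff_append
    using uv by (intro exI[of _ "rev u @ [k]"] exI[of _ v]) (auto simp: p split_words_def)
  moreover have "immediately_before k 1 p"
    using p immediately_before_iff_append by blast
  ultimately show "p \<in> MM' n k"
    using perm assms by (simp add: MM'_def MM_def)
qed

text \<open>The letter \<open>k\<close> occurs only once and so marks where the two parts
  separate.\<close>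

lemma inj_on_split_words:
  "inj_on (\<lambda>(u, w). rev u @ k # w) (split_words n k)"
proof (rule inj_onI, clarify)
  fix u w u' w'
  assume uw: "(u, w) \<in> split_words n k" "(u', w') \<in> split_words n k"
    and eq: "rev u @ k # w = rev u' @ k # w'"
  have "k \<notin> set u" "k \<notin> set w" "k \<notin> set u'" "k \<notin> set w'"
    using uw by (auto simp: split_words_def permutations_of_set_def)
  then show "u = u' \<and> w = w'"
    using eq append_Cons_eq_iff[of k "rev u" w "rev u'" w'] by simp
qed

section \<open>The bijection from split words to down-up permutations\<close>

definition split_to_entringer :: "nat \<Rightarrow> nat list \<times> nat list \<Rightarrow> nat list" where
  "split_to_entringer k = (\<lambda>(u, w).
     k # u @ (if even (length u) then w else map (order_reversal (set w)) w))"

text \<open>Makes the cut recoverable: the tail starts with \<open>1\<close> or \<open>n\<close>,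
  while both letters lie in \<open>w\<close> and hence neither in \<open>u\<close>.\<close>

lemma split_words_tail:
  assumes "(u, w) \<in> split_words n k"
  obtains y z where "(if even (length u) then w else map (order_reversal (set w)) w) = y # z"
    "y = 1 \<or> y = n" "\<And>x. x \<in> set u \<Longrightarrow> x \<noteq> 1 \<and> x \<noteq> n"
    "odd (length u) \<Longrightarrow> y = n"
proof -
  obtain v where w: "w = 1 # v" "n \<in> set w" and perm: "k # u @ w \<in> permutations_of_set {1..n}"
    using assms by (auto simp: split_words_def)
  have "set w \<subseteq> {1..n}" using perm by (auto simp: permutations_of_set_def)
  then have "order_reversal (set w) 1 = n"
    using w by (intro order_reversal_least) auto
  moreover have "\<And>x. x \<in> set u \<Longrightarrow> x \<noteq> 1 \<and> x \<noteq> n"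
    using perm w by (auto simp: permutations_of_set_def)
  ultimately show thesis
    using that[of 1 v] that[of n "map (order_reversal (set w)) v"] w(1)
    by (cases "even (length u)") simp_all
qed

lemma split_to_entringer_mem:
  assumes "1 \<le> k" "k < n" "(u, w) \<in> split_words n k"
  shows "split_to_entringer k (u, w) \<in> entringer_perms n k"
proof -
  obtain v where w: "w = 1 # v" "n \<in> set w" and perm: "k # u @ w \<in> permutations_of_set {1..n}"
    and zz: "zigzag True (k # u)" "zigzag False w"
    using assms by (auto simp: split_words_def)
  \<comment> \<open>Both extremes belong to \<open>w\<close>, so the comparison at the junction
    depends only on which of them begins the tail.\<close>
  have less: "1 < x \<and> x < n" if "x \<in> set (k # u)" for x
  proof -
    have "x \<in> {1..n}" "x \<notin> set w"
      using perm that by (auto simp: permutations_of_set_def)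
    then show ?thesis using w by (cases "x = 1"; cases "x = n") auto
  qed
  have "last (k # u) \<in> set (k # u)" by (rule last_in_set) simp
  from less[OF this] have last: "1 < last (k # u)" "last (k # u) < n" by auto
  define w' where "w' = (if even (length u) then w else map (order_reversal (set w)) w)"
  have "distinct w" using perm by (simp add: permutations_of_set_def)
  then have "distinct w'" "set w' = set w"
    using distinct_map_order_reversal unfolding w'_def by auto
  then have "(k # u) @ w' \<in> permutations_of_set {1..n}"
    using perm by (auto simp: permutations_of_set_def)
  \<comment> \<open>After the \<open>length u + 1\<close> letters of \<open>k # u\<close> the tail
    must carry the flag \<open>odd (length u)\<close>; order reversal turns the flag
    \<open>False\<close> of \<open>w\<close> into \<open>True\<close> exactly in the odd
    case.\<close>
  moreover have "zigzag (odd (length u)) w'"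
    unfolding w'_def using zz zigzag_map_order_reversal by simp
  moreover have "if even (length u) then hd w' = 1 else hd w' = n"
    using split_words_tail[OF assms(3)] w(1) unfolding w'_def by (metis list.sel(1))
  then have "if even (length u) then last (k # u) > hd w' else last (k # u) < hd w'"
    using last by (auto split: if_splits)
  ultimately have "(k # u) @ w' \<in> entringer_perms n k"
    unfolding entringer_perms_def mem_Collect_eq zigzag_append using zz by (auto split: if_splits)
  then show ?thesis by (simp add: split_to_entringer_def w'_def)
qed

lemma inj_on_split_to_entringer:
  "inj_on (split_to_entringer k) (split_words n k)"
proof (rule inj_onI, clarify)
  fix u w u' w'
  assume uw: "(u, w) \<in> split_words n k" and uw': "(u', w') \<in> split_words n k"
    and eq: "split_to_entringer k (u, w) = split_to_entringer k (u', w')"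
  let ?t = "\<lambda>u w. if even (length u) then w else map (order_reversal (set w)) w"
  \<comment> \<open>\<open>u\<close> is read off as the longest prefix free of \<open>1\<close> and
    \<open>n\<close>.\<close>
  have tw: "takeWhile (\<lambda>x. x \<noteq> 1 \<and> x \<noteq> n) (u @ ?t u w) = u" if mem: "(u, w) \<in> split_words n k" for u w
  proof -
    obtain y z where "?t u w = y # z" "y = 1 \<or> y = n" "\<And>x. x \<in> set u \<Longrightarrow> x \<noteq> 1 \<and> x \<noteq> n"
      using split_words_tail[OF mem] by blast
    then show ?thesis by (simp add: takeWhile_append2)
  qed
  have eq': "u @ ?t u w = u' @ ?t u' w'"
    using eq by (simp add: split_to_entringer_def)
  then have u: "u = u'" using tw[OF uw] tw[OF uw'] by metis
  \<comment> \<open>Equal first parts leave equal letter sets, so both tails undergo the same order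
    reversal, which is injective.\<close>
  have "set w = {1..n} - set (k # u)" "set w' = {1..n} - set (k # u')"
    using uw uw' by (auto simp: split_words_def permutations_of_set_def)
  then have set: "set w = set w'" using u by simp
  have "inj_on (order_reversal (set w)) (set w)"
    using bij_betw_order_reversal[of "set w"] by (simp add: bij_betw_def)
  then have "w = w'"
    using eq' by (cases "even (length u)") (simp_all add: u set inj_on_map_eq_map)
  then show "u = u' \<and> w = w'" using u by simp
qed

lemma entringer_perms_subset_image:
  assumes "1 \<le> k" "k < n"
  shows "entringer_perms n k \<subseteq> split_to_entringer k ` split_words n k"
proof
  fix p assume "p \<in> entringer_perms n k"
  then have perm: "p \<in> permutations_of_set {1..n}" and zz: "zigzag True p" and hd: "p ! 0 = k"
    by (auto simp: entringer_perms_def)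
  have len: "length p = n" using perm by (rule length_permutation)
  then obtain c where p: "p = k # c" and "c \<noteq> []"
    using hd assms by (cases p; cases "tl p") auto
  \<comment> \<open>The word starts with a descent, so its first letter cannot be \<open>1\<close>;
    with \<open>k < n\<close> both extremes lie further right.\<close>
  then have "1 < k"
    using zz perm by (cases c) (auto simp: permutations_of_set_def)
  have "n \<in> set p" using perm assms by (auto simp: permutations_of_set_def)
  then have "\<exists>x\<in>set c. x = 1 \<or> x = n" using p assms by auto
  then obtain u x v where c: "c = u @ x # v" and x: "x = 1 \<or> x = n"
    and u: "\<forall>y\<in>set u. \<not> (y = 1 \<or> y = n)"
    by (rule split_list_first_propE)
  have sub: "set (x # v) \<subseteq> {1..n}" and dist: "distinct (x # v)"
    using perm by (auto simp: p c permutations_of_set_def)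
  have "{1..n} = set (k # u) \<union> set (x # v)"
    using perm by (auto simp: p c permutations_of_set_def)
  then have mem: "1 \<in> set (x # v)" "n \<in> set (x # v)"
    using u \<open>1 < k\<close> \<open>k < n\<close> by (auto simp: set_eq_iff)
  have p': "p = (k # u) @ x # v" by (simp add: p c)
  have less: "1 < y \<and> y < n" if "y \<in> set (k # u)" for y
  proof -
    have "y \<in> {1..n}" using that perm unfolding p' by (auto simp: permutations_of_set_def)
    moreover have "y \<noteq> 1 \<and> y \<noteq> n" using that u \<open>1 < k\<close> \<open>k < n\<close> by auto
    ultimately show ?thesis by auto
  qed
  have "last (k # u) \<in> set (k # u)" by (rule last_in_set) simp
  from less[OF this] have last: "1 < last (k # u)" "last (k # u) < n" by auto
  have zu: "zigzag True (k # u)" and zv: "zigzag (odd (length u)) (x # v)"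
    and junction: "if even (length u) then last (k # u) > x else last (k # u) < x"
    using zz unfolding p' zigzag_append by (auto split: if_splits)
  show "p \<in> split_to_entringer k ` split_words n k"
  \<comment> \<open>The parity of \<open>length u\<close> decides whether the junction is a descent,
    leaving only \<open>x = 1\<close>, or an ascent, leaving only \<open>x = n\<close>.\<close>
  proof (cases "even (length u)")
    case True
    then have "x = 1" using x junction last by auto
    then have "(u, x # v) \<in> split_words n k"
      using True perm zu zv mem unfolding split_words_def by (simp add: p c)
    moreover have "split_to_entringer k (u, x # v) = p"
      using True by (simp add: split_to_entringer_def p c)
    ultimately show ?thesis by (metis imageI)
  next
    case False
    then have "x = n" using x junction last by auto
    obtain w where w: "x # v = map (order_reversal (set (x # v))) w" "set w = set (x # v)"
      "distinct w"
      using map_order_reversal_surj[of "x # v"] dist by metis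
    have w': "x # v = map (order_reversal (set w)) w"
      using w(1) unfolding w(2) .
    obtain y z where yz: "w = y # z" using w by (cases w) auto
    \<comment> \<open>The preimage word begins with \<open>1\<close>, since \<open>1\<close> and its
      first letter \<open>y\<close> are both sent to \<open>n\<close>.\<close>
    have "order_reversal (set w) 1 = n"
      using mem sub unfolding w(2)[symmetric] by (intro order_reversal_least) auto
    moreover have "order_reversal (set w) y = n" using w' yz \<open>x = n\<close> by simp
    moreover have "inj_on (order_reversal (set w)) (set w)"
      using bij_betw_order_reversal[of "set w"] by (simp add: bij_betw_def)
    ultimately have "y = 1" using mem w(2) yz by (metis inj_onD list.set_intros(1))
    have "k # u @ w \<in> permutations_of_set {1..n}"
      using perm w(2,3) by (auto simp: p' permutations_of_set_def)
    moreover have "zigzag False w"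
      using zv False zigzag_map_order_reversal[of True w] w' by simp
    ultimately have "(u, w) \<in> split_words n k"
      using zu mem w(2) \<open>y = 1\<close> yz unfolding split_words_def by simp
    moreover have "split_to_entringer k (u, w) = p"
      using False w' by (simp add: split_to_entringer_def p')
    ultimately show ?thesis by (metis imageI)
  qed
qed

section \<open>Cardinality of \<open>MM' n k\<close>\<close>

lemma card_MM'_less:
  assumes "1 \<le> k" "k < n"
  shows "card (MM' n k) = entringer n k"
proof -
  have "split_to_entringer k ` split_words n k = entringer_perms n k"
    using entringer_perms_subset_image[OF assms] split_to_entringer_mem[OF assms] by auto
  \<comment> \<open>Both sets are injective images of \<open>split_words n k\<close>.\<close>
  then show ?thesis
    using card_image[OF inj_on_split_words[of k n]]
      card_image[OF inj_on_split_to_entringer[of k n]]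
    by (simp add: MM'_eq_image[OF assms] entringer_eq_card)
qed

text \<open>A first letter \<open>1\<close> can only be followed by an ascent, and \<open>n\<close>
  cannot stand before position 0.\<close>

lemma MM'_self:
  assumes "n \<ge> 1"
  shows "MM' n n = {w \<in> permutations_of_set {1..n}. zigzag False w \<and> w ! 0 = 1}"
proof -
  have "zigzag False w"
    if w: "w \<in> permutations_of_set {1..n}" "w ! 0 = 1" and alt: "alternating w" for w
  proof -
    obtain b where b: "zigzag b w" using alt alternating_iff_zigzag by blast
    show ?thesis
      using b w by (cases "(b, w)" rule: zigzag.cases; cases b) (auto simp: permutations_of_set_def)
  qed
  moreover have "\<exists>i j. i \<le> j \<and> j < length w \<and> w ! i = 1 \<and> w ! j = n"
    if w: "w \<in> permutations_of_set {1..n}" "w ! 0 = 1" for w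
  proof -
    have "n \<in> set w" using w assms by (simp add: permutations_of_set_def)
    then show ?thesis using w(2) by (metis in_set_conv_nth le0)
  qed
  ultimately show ?thesis
    unfolding MM'_def MM_def using alternating_iff_zigzag by auto
qed

text \<open>Complementation is an involution that exchanges an initial \<open>1\<close> with an
  initial \<open>n\<close> and flips the flag.\<close>

lemma card_MM'_self:
  assumes "n \<ge> 1"
  shows "card (MM' n n) = entringer n n"
proof -
  have nth: "complement w ! 0 = n + 1 - w ! 0" if "w \<in> permutations_of_set {1..n}" for w
    using length_permutation[OF that] assms by (simp add: complement_def)
  have "bij_betw complement (MM' n n) (entringer_perms n n)"
    using assms
    by (intro bij_betw_byWitness[where f' = complement])
      (auto simp: MM'_self entringer_perms_def complement_complement complement_permutation
        zigzag_complement nth simp del: One_nat_def)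
  then show ?thesis by (simp add: bij_betw_same_card entringer_eq_card)
qed

theorem theorem9:
  fixes n k :: nat
  assumes "n \<ge> 1" and "k \<in> {1..n}"
  shows "bij_betw rho' (MM' n k) (MM'' n k) \<and> card (MM'' n k) = entringer n k"
proof -
  have bij: "bij_betw rho' (MM' n k) (MM'' n k)"
    using assms by (rule bij_betw_rho')
  moreover have "card (MM' n k) = entringer n k"
    using assms card_MM'_less[of k n] card_MM'_self[of n] by (cases "k = n") auto
  ultimately show ?thesis using bij_betw_same_card by metis
qed

end
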